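(* Let $(M,\mathcal T)$ be a closed triangulated surface with inversive distance $I\ge0$ in hyperbolic background geometry. For every $r\in\Omega$ and every nonempty proper subset $A\subset V$, the discrete Gaussian curvatures $K_i=K_i(r)$ satisfy $$\sum_{i\in A}K_i>-\sum_{(e,v)\in Lk(A)}\big(\pi-\Lambda(I_e)\big)+2\pi\chi(F_A).$$
   Context: Setting. $M$ is a closed surface with a triangulation $\mathcal T=\{V,E,F\}$ (vertices, edges, faces), with vertices numbered $1,\dots,N$. The inversive distance is a fixed function $I:E\to[0,+\infty)$, with value $I_e$ or $I_{ij}$ on the edge $e=\{ij\}$. For $r=(r_1,\dots,r_N)\in\mathbb R^N_{>0}$, each edge $\{ij\}$ gets the hyperbolic length $l_{ij}=\cosh^{-1}(\cosh r_i\cosh r_j+I_{ij}\sinh r_i\sinh r_j)$. $\Omega$ is the set of $r\in\mathbb R^N_{>0}$ such that for every face $\{ijk\}\in F$ the lengths $l_{ij},l_{jk},l_{ik}$ satisfy the three strict triangle inequalities. For $r\in\Omega$, $\theta_i^{jk}$ is the inner angle at vertex $i$ of the hyperbolic triangle with edge lengths $l_{ij},l_{jk},l_{ik}$, and $K_i(r)=2\pi-\sum_{\{ijk\}\in F}\theta_i^{jk}$ (sum over faces containing $i$). Notation. $F_A$ is the subcomplex of $\mathcal T$ consisting of all simplices whose vertices all lie in $A$, and $\chi(F_A)$ is its Euler characteristic. $Lk(A)$ is the set of pairs $(e,v)$ of an edge $e$ and a vertex $v$ such that the end points of $e$ are not in $A$, $v\in A$, and $e$ and $v$ form a triangle of $F$.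 The function $\Lambda:\mathbb R\to[0,\pi]$ is $\Lambda(x)=\pi$ for $x\le-1$, $\Lambda(x)=\arccos x$ for $-1\le x\le1$, $\Lambda(x)=0$ for $x\ge1$. *)

theory Defs
  imports "HOL-Analysis.Analysis"
begin

text \<open>
  \<^bold>\<open>Closed triangulated surfaces.\<close>  Connectedness is not part of the definition of a surface.
\<close>

definition closed_surface :: "'m topology \<Rightarrow> bool" where
  "closed_surface M \<longleftrightarrow>
     compact_space M \<and> Hausdorff_space M \<and> second_countable M \<and>
     (\<forall>p \<in> topspace M. \<exists>U. openin M U \<and> p \<in> U \<and>
        (\<exists>W :: (real ^ 2) set. open W \<and> subtopology M U homeomorphic_space top_of_set W))"

text \<open>
  Simplices are nonempty finite sets of vertices: edges are two-element sets and faces are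
  three-element sets.
\<close>

definition simplices :: "nat set \<Rightarrow> nat set set \<Rightarrow> nat set set \<Rightarrow> nat set set" where
  "simplices V E F = (\<lambda>v. {v}) ` V \<union> E \<union> F"

definition two_dim_complex :: "nat set \<Rightarrow> nat set set \<Rightarrow> nat set set \<Rightarrow> bool" where
  "two_dim_complex V E F \<longleftrightarrow>
     (\<forall>e\<in>E. e \<subseteq> V \<and> card e = 2) \<and> (\<forall>f\<in>F. f \<subseteq> V \<and> card f = 3) \<and>
     (\<forall>\<sigma> \<in> simplices V E F. \<forall>\<tau>. \<tau> \<subseteq> \<sigma> \<and> \<tau> \<noteq> {} \<longrightarrow> \<tau> \<in> simplices V E F)"

text \<open>
  The geometric realization, in barycentric coordinates.  For finitely many vertices the product
  topology on \<^typ>\<open>nat \<Rightarrow> real\<close> induces the usual topology on it.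
\<close>

definition realization :: "nat set set \<Rightarrow> (nat \<Rightarrow> real) set" where
  "realization S =
     {x. (\<forall>i. 0 \<le> x i) \<and> {i. x i \<noteq> 0} \<in> S \<and> (\<Sum>i | x i \<noteq> 0. x i) = 1}"

definition triangulation_of ::
  "nat set \<Rightarrow> nat set set \<Rightarrow> nat set set \<Rightarrow> 'm topology \<Rightarrow> bool" where
  "triangulation_of V E F M \<longleftrightarrow>
     two_dim_complex V E F \<and>
     top_of_set (realization (simplices V E F)) homeomorphic_space M"

text \<open>\<^bold>\<open>Subcomplexes and links.\<close>\<close>

definition subcomplex ::
  "nat set \<Rightarrow> nat set set \<Rightarrow> nat set set \<Rightarrow> nat set \<Rightarrow> nat set set" where
  "subcomplex V E F A = {\<sigma> \<in> simplices V E F. \<sigma> \<subseteq> A}"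

definition euler_char :: "nat set set \<Rightarrow> int" where
  "euler_char S = (\<Sum>\<sigma>\<in>S. (- 1) ^ (card \<sigma> - 1))"

definition Lk :: "nat set set \<Rightarrow> nat set set \<Rightarrow> nat set \<Rightarrow> (nat set \<times> nat) set" where
  "Lk E F A = {(e, v). e \<in> E \<and> e \<inter> A = {} \<and> v \<in> A \<and> insert v e \<in> F}"

definition Lam :: "real \<Rightarrow> real" where
  "Lam x = (if x \<le> - 1 then pi else if x \<le> 1 then arccos x else 0)"

text \<open>
  \<^bold>\<open>Hyperbolic angles.\<close>  The hyperbolic plane is the upper sheet of the hyperboloid in Minkowski
  space, with points written as \<open>(t, x, y)\<close>.  For two points \<open>p \<noteq> q\<close> of it, the vector
  \<open>q + \<langle>p, q\<rangle> p\<close> is a positive multiple of the initial velocity of the geodesic from \<open>p\<close> to \<open>q\<close>.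
\<close>

definition mink :: "real \<times> real \<times> real \<Rightarrow> real \<times> real \<times> real \<Rightarrow> real" where
  "mink = (\<lambda>(t, x, y) (t', x', y'). x * x' + y * y' - t * t')"

definition hyp_plane :: "(real \<times> real \<times> real) set" where
  "hyp_plane = {p. mink p p = - 1 \<and> 0 < fst p}"

definition hyp_dist :: "real \<times> real \<times> real \<Rightarrow> real \<times> real \<times> real \<Rightarrow> real" where
  "hyp_dist p q = arcosh (- mink p q)"

definition direction ::
  "real \<times> real \<times> real \<Rightarrow> real \<times> real \<times> real \<Rightarrow> real \<times> real \<times> real" where
  "direction p q = q + mink p q *\<^sub>R p"

definition hyp_angle ::
  "real \<times> real \<times> real \<Rightarrow> real \<times> real \<times> real \<Rightarrow> real \<times> real \<times> real \<Rightarrow> real" where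
  "hyp_angle p q s =
     arccos (mink (direction p q) (direction p s) /
       (sqrt (mink (direction p q) (direction p q)) * sqrt (mink (direction p s) (direction p s))))"

text \<open>
  The angle between the sides of lengths \<open>a\<close> and \<open>b\<close>, opposite to the side of length \<open>c\<close>.  The
  lemma below shows that the description is proper whenever the triangle inequalities hold.
\<close>

definition triangle_angle :: "real \<Rightarrow> real \<Rightarrow> real \<Rightarrow> real" where
  "triangle_angle a b c =
     (THE \<theta>. \<exists>p\<in>hyp_plane. \<exists>q\<in>hyp_plane. \<exists>s\<in>hyp_plane.
        hyp_dist p q = a \<and> hyp_dist p s = b \<and> hyp_dist q s = c \<and> \<theta> = hyp_angle p q s)"

lemma mink_hyp_plane_le:
  assumes "p \<in> hyp_plane" "q \<in> hyp_plane"
  shows "mink p q \<le> - 1"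
proof -
  obtain t x y where p: "p = (t, x, y)" by (cases p) auto
  obtain t' x' y' where q: "q = (t', x', y')" by (cases q) auto
  have t: "t\<^sup>2 = 1 + x\<^sup>2 + y\<^sup>2" "t > 0" and t': "t'\<^sup>2 = 1 + x'\<^sup>2 + y'\<^sup>2" "t' > 0"
    using assms by (auto simp: hyp_plane_def p q mink_def power2_eq_square algebra_simps)
  have "(t * t')\<^sup>2 - (1 + x * x' + y * y')\<^sup>2 =
      (x - x')\<^sup>2 + (y - y')\<^sup>2 + (x * y' - x' * y)\<^sup>2"
    unfolding power_mult_distrib t t' by (simp add: power2_eq_square algebra_simps)
  then have "(1 + x * x' + y * y')\<^sup>2 \<le> (t * t')\<^sup>2"
    by (smt (verit) zero_le_power2)
  then have "1 + x * x' + y * y' \<le> t * t'"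
    using t t' by (meson less_eq_real_def mult_pos_pos power2_le_imp_le)
  then show ?thesis by (simp add: mink_def p q)
qed

lemma cosh_hyp_dist:
  assumes "p \<in> hyp_plane" "q \<in> hyp_plane"
  shows "cosh (hyp_dist p q) = - mink p q"
  using mink_hyp_plane_le[OF assms] by (simp add: hyp_dist_def)

lemma hyp_angle_law_of_cosines:
  assumes "p \<in> hyp_plane" "q \<in> hyp_plane" "s \<in> hyp_plane"
    and "hyp_dist p q = a" "hyp_dist p s = b" "hyp_dist q s = c" "0 \<le> a" "0 \<le> b"
  shows "hyp_angle p q s = arccos ((cosh a * cosh b - cosh c) / (sinh a * sinh b))"
proof -
  have pp: "mink p p = - 1" "mink q q = - 1" "mink s s = - 1"
    using assms by (auto simp: hyp_plane_def)
  have d: "mink p q = - cosh a" "mink p s = - cosh b" "mink q s = - cosh c"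
    using cosh_hyp_dist[of p q] cosh_hyp_dist[of p s] cosh_hyp_dist[of q s] assms by simp_all
  have bil: "mink (direction p u) (direction p v) =
      mink u v + mink p v * mink p u * (2 + mink p p)" for u v
    by (cases p; cases u; cases v) (simp add: mink_def direction_def algebra_simps)
  have 1: "mink (direction p q) (direction p s) = cosh a * cosh b - cosh c"
    unfolding bil by (simp add: pp d)
  have 2: "mink (direction p q) (direction p q) = (sinh a)\<^sup>2"
    "mink (direction p s) (direction p s) = (sinh b)\<^sup>2"
    unfolding bil by (simp_all add: pp d sinh_square_eq flip: power2_eq_square)
  show ?thesis
    unfolding hyp_angle_def 1 2 using assms(7,8) by simp
qed

lemma triangle_angle_law_of_cosines:
  assumes "0 < a" "0 < b" "0 < c" "a < b + c" "b < a + c" "c < a + b"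
  shows "triangle_angle a b c = arccos ((cosh a * cosh b - cosh c) / (sinh a * sinh b))"
proof -
  define x where "x = (cosh a * cosh b - cosh c) / (sinh a * sinh b)"
  have pos: "0 < sinh a * sinh b" using assms by simp
  have "cosh c \<le> cosh (a + b)"
    using assms by (simp add: cosh_real_nonneg_le_iff)
  moreover have "cosh \<bar>a - b\<bar> \<le> cosh c"
    by (subst cosh_real_nonneg_le_iff) (use assms in auto)
  then have "cosh (a - b) \<le> cosh c" by (metis cosh_real_abs)
  ultimately have x: "- 1 \<le> x" "x \<le> 1"
    using pos by (simp_all add: x_def field_simps cosh_add cosh_diff)
  define p q s where "p = (1 :: real, 0 :: real, 0 :: real)"
    and "q = (cosh a, sinh a, 0 :: real)"
    and "s = (cosh b, sinh b * cos (arccos x), sinh b * sin (arccos x))"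
  have sc: "(sin (arccos x))\<^sup>2 = 1 - x\<^sup>2" "cos (arccos x) = x"
    using x by (simp_all add: sin_squared_eq)
  have mem: "p \<in> hyp_plane" "q \<in> hyp_plane" "s \<in> hyp_plane"
    by (simp_all add: hyp_plane_def mink_def p_def q_def s_def cosh_real_pos cosh_square_eq sc
        power_mult_distrib algebra_simps flip: power2_eq_square)
  have "mink q s = - cosh c"
    using assms by (simp add: mink_def q_def s_def sc) (simp add: x_def)
  then have d: "hyp_dist p q = a" "hyp_dist p s = b" "hyp_dist q s = c"
    using assms
    by (simp_all add: hyp_dist_def, simp_all add: p_def q_def s_def mink_def arcosh_cosh_real)
  show ?thesis
    unfolding triangle_angle_def
  proof (rule the_equality)
    show "\<exists>p\<in>hyp_plane. \<exists>q\<in>hyp_plane. \<exists>s\<in>hyp_plane.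
        hyp_dist p q = a \<and> hyp_dist p s = b \<and> hyp_dist q s = c \<and>
        arccos ((cosh a * cosh b - cosh c) / (sinh a * sinh b)) = hyp_angle p q s"
      using mem d assms hyp_angle_law_of_cosines[of p q s a b c] by fastforce
  qed (use assms hyp_angle_law_of_cosines in force)
qed

text \<open>
  \<^bold>\<open>Inversive distance circle packings.\<close>  The weight \<open>I\<close> is a function on edges, and the radii
  \<open>r\<close> only matter on the vertex set.
\<close>

definition edge_length :: "(nat set \<Rightarrow> real) \<Rightarrow> (nat \<Rightarrow> real) \<Rightarrow> nat \<Rightarrow> nat \<Rightarrow> real" where
  "edge_length I r i j =
     arcosh (cosh (r i) * cosh (r j) + I {i, j} * sinh (r i) * sinh (r j))"

definition Omega :: "nat set \<Rightarrow> nat set set \<Rightarrow> (nat set \<Rightarrow> real) \<Rightarrow> (nat \<Rightarrow> real) set" where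
  "Omega V F I =
     {r. (\<forall>i\<in>V. 0 < r i) \<and>
        (\<forall>i j k. {i, j, k} \<in> F \<longrightarrow>
           edge_length I r i j < edge_length I r j k + edge_length I r i k \<and>
           edge_length I r j k < edge_length I r i j + edge_length I r i k \<and>
           edge_length I r i k < edge_length I r i j + edge_length I r j k)}"

definition inner_angle ::
  "(nat set \<Rightarrow> real) \<Rightarrow> (nat \<Rightarrow> real) \<Rightarrow> nat \<Rightarrow> nat \<Rightarrow> nat \<Rightarrow> real" where
  "inner_angle I r i j k =
     triangle_angle (edge_length I r i j) (edge_length I r i k) (edge_length I r j k)"

text \<open>
  Requiring \<open>j < k\<close> makes each face \<open>{i, j, k}\<close> containing \<open>i\<close> contribute exactly once.
\<close>

definition curvature ::
  "nat set set \<Rightarrow> (nat set \<Rightarrow> real) \<Rightarrow> (nat \<Rightarrow> real) \<Rightarrow> nat \<Rightarrow> real" where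
  "curvature F I r i =
     2 * pi - (\<Sum>(j, k) | j < k \<and> {i, j, k} \<in> F. inner_angle I r i j k)"

end

theory Submission
  imports Defs
begin

text \<open>
  Exchanging the order of summation, \<open>\<Sum>i\<in>A. K\<^sub>i\<close> is \<open>2 * pi * card A\<close> minus the sum over all faces of
  the angles at their vertices in \<open>A\<close>.  A face with two or three vertices in \<open>A\<close> contributes less
  than \<open>pi\<close>, because the angle sum of a hyperbolic triangle is less than \<open>pi\<close>
  (\<open>hyperbolic_angle_sum\<close>).  A face with a single vertex in \<open>A\<close>, opposite to the edge \<open>e\<close>, is the
  same as an element of \<open>Lk(A)\<close>, and it contributes less than \<open>pi - Lam (I e)\<close>: each side of the triangle is
  longer than the radii at its ends, so that the law of cosines and \<open>I \<ge> 0\<close> bound the cosine of the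
  angle from below by \<open>- I e\<close> (\<open>triangle_angle_less_pi_minus_Lam\<close>).

  It remains to recognize the Euler characteristic.  Let \<open>f\<^sub>2\<close> and \<open>f\<^sub>3\<close> be the numbers of faces with
  exactly two and with three vertices in \<open>A\<close>, and \<open>n\<close> the number of edges inside \<open>A\<close>.  A face of the
  first kind has one edge inside \<open>A\<close>, a face of the second kind three, and no edge is in more than
  two faces, so \<open>f\<^sub>2 + 3 * f\<^sub>3 \<le> 2 * n\<close> (\<open>edge_face_incidences\<close>).  Hence
  \<open>pi * (f\<^sub>2 + f\<^sub>3) \<le> 2 * pi * n - 2 * pi * f\<^sub>3\<close>, and \<open>2 * pi * card A\<close> minus the right side
  is \<open>2 * pi * \<chi>(F\<^sub>A)\<close>.  The inequality is strict because some face has a vertex in \<open>A\<close>.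

  Two facts about triangulations of surfaces enter: no edge is in three faces
  (\<open>edge_in_at_most_two_faces\<close>, from invariance of domain), and every vertex is in a face
  (\<open>vertex_in_face\<close>, from invariance of dimension).
\<close>

section \<open>Angles of hyperbolic triangles\<close>

definition triangle_ineqs :: "real \<Rightarrow> real \<Rightarrow> real \<Rightarrow> bool" where
  "triangle_ineqs a b c \<longleftrightarrow> a < b + c \<and> b < a + c \<and> c < a + b"

text \<open>
  Up to sign, the Gram determinant, for the Minkowski form, of the three vertices of a hyperbolic
  triangle with sides \<open>a\<close>, \<open>b\<close>, \<open>c\<close>.  Its symmetry in the sides is what makes it useful: the sines of
  all three angles are its square root divided by two hyperbolic sines.
\<close>

definition gram :: "real \<Rightarrow> real \<Rightarrow> real \<Rightarrow> real" where
  "gram a b c =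
     1 + 2 * cosh a * cosh b * cosh c - (cosh a)\<^sup>2 - (cosh b)\<^sup>2 - (cosh c)\<^sup>2"

lemma triangle_ineqs_permute:
  assumes "triangle_ineqs a b c"
  shows "triangle_ineqs b a c" "triangle_ineqs b c a" "triangle_ineqs c a b"
    "triangle_ineqs a c b"
  using assms by (auto simp: triangle_ineqs_def)

lemma triangle_ineqs_pos:
  assumes "triangle_ineqs a b c"
  shows "0 < a" "0 < b" "0 < c"
  using assms by (auto simp: triangle_ineqs_def)

text \<open>
  The strict triangle inequalities say \<open>cosh (a - b) < cosh c < cosh (a + b)\<close>, and expanding the
  outer terms by the addition theorem turns this into the two bounds.
\<close>

lemma cosine_bounds:
  assumes "triangle_ineqs a b c"
  shows "- 1 < (cosh a * cosh b - cosh c) / (sinh a * sinh b)"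
    and "(cosh a * cosh b - cosh c) / (sinh a * sinh b) < 1"
proof -
  note pos = triangle_ineqs_pos[OF assms]
  have "0 < sinh a * sinh b" using pos by simp
  moreover have "cosh c < cosh (a + b)"
    using assms pos by (simp add: triangle_ineqs_def cosh_real_nonneg_less_iff)
  moreover have "cosh \<bar>a - b\<bar> < cosh c"
    by (subst cosh_real_nonneg_less_iff) (use assms in \<open>auto simp: triangle_ineqs_def\<close>)
  then have "cosh (a - b) < cosh c" by (metis cosh_real_abs)
  ultimately show "- 1 < (cosh a * cosh b - cosh c) / (sinh a * sinh b)"
    and "(cosh a * cosh b - cosh c) / (sinh a * sinh b) < 1"
    by (simp_all add: field_simps cosh_add cosh_diff)
qed

lemma triangle_angle_eq:
  assumes "triangle_ineqs a b c"
  shows "triangle_angle a b c = arccos ((cosh a * cosh b - cosh c) / (sinh a * sinh b))"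
  using assms triangle_ineqs_pos[OF assms]
  by (intro triangle_angle_law_of_cosines) (auto simp: triangle_ineqs_def)

lemma triangle_angle_commute:
  assumes "triangle_ineqs a b c"
  shows "triangle_angle b a c = triangle_angle a b c"
  using triangle_angle_eq[OF assms] triangle_angle_eq[OF triangle_ineqs_permute(1)[OF assms]]
  by (simp add: mult.commute)

lemma triangle_angle_bounds:
  assumes "triangle_ineqs a b c"
  shows "0 < triangle_angle a b c" and "triangle_angle a b c < pi"
  using arccos_lt_bounded[OF cosine_bounds[OF assms]] by (simp_all add: triangle_angle_eq[OF assms])

lemma cos_triangle_angle:
  assumes "triangle_ineqs a b c"
  shows "cos (triangle_angle a b c) = (cosh a * cosh b - cosh c) / (sinh a * sinh b)"
  using cosine_bounds[OF assms] by (simp add: triangle_angle_eq[OF assms])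

lemma sin_triangle_angle:
  assumes "triangle_ineqs a b c"
  shows "sin (triangle_angle a b c) = sqrt (gram a b c) / (sinh a * sinh b)"
proof -
  let ?t = "triangle_angle a b c"
  note pos = triangle_ineqs_pos[OF assms]
  have S: "0 < sinh a * sinh b" using pos by simp
  have "cos ?t * (sinh a * sinh b) = cosh a * cosh b - cosh c"
    using pos by (simp add: cos_triangle_angle[OF assms])
  then have "(cos ?t)\<^sup>2 * (sinh a * sinh b)\<^sup>2 = (cosh a * cosh b - cosh c)\<^sup>2"
    by (metis power_mult_distrib)
  moreover have "(sin ?t * (sinh a * sinh b))\<^sup>2 =
      (sinh a)\<^sup>2 * (sinh b)\<^sup>2 - (cos ?t)\<^sup>2 * (sinh a * sinh b)\<^sup>2"
    by (simp add: power_mult_distrib sin_squared_eq algebra_simps)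
  ultimately have "(sin ?t * (sinh a * sinh b))\<^sup>2 = gram a b c"
    by (simp add: gram_def sinh_square_eq power2_diff algebra_simps power_mult_distrib)
  moreover have "0 \<le> sin ?t * (sinh a * sinh b)"
    using triangle_angle_bounds[OF assms] S by (simp add: sin_ge_zero)
  ultimately have "sqrt (gram a b c) = sin ?t * (sinh a * sinh b)"
    by (metis real_sqrt_unique)
  then show ?thesis using pos by simp
qed

text \<open>
  Both sides have the denominator \<open>sinh a * sinh b * (sinh c)\<^sup>2\<close> once the law of cosines is inserted,
  and the numerators then agree as polynomials in \<open>cosh a\<close>, \<open>cosh b\<close>, \<open>cosh c\<close>.
\<close>

lemma dual_law_of_cosines:
  assumes "triangle_ineqs a b c"
  shows "cos (triangle_angle a b c) =
    sin (triangle_angle b c a) * sin (triangle_angle a c b) * cosh c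
      - cos (triangle_angle b c a) * cos (triangle_angle a c b)"
proof -
  note pos = triangle_ineqs_pos[OF assms]
  have S: "0 < sinh a" "0 < sinh b" "0 < sinh c" using pos by simp_all
  have t: "triangle_ineqs b c a" "triangle_ineqs a c b"
    using triangle_ineqs_permute[OF assms] by auto
  have g: "gram a c b = gram a b c" "gram b c a = gram a b c"
    by (simp_all add: gram_def)
  have "0 \<le> gram a b c"
  proof -
    have "0 \<le> sqrt (gram a b c) / (sinh a * sinh b)"
      using triangle_angle_bounds[OF assms] sin_triangle_angle[OF assms]
      by (metis less_imp_le sin_ge_zero)
    then show ?thesis using mult_pos_pos[OF S(1,2)] by (simp add: zero_le_divide_iff)
  qed
  then have "sin (triangle_angle b c a) * sin (triangle_angle a c b) =
      gram a b c / (sinh a * sinh b * (sinh c)\<^sup>2)"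
    by (simp add: sin_triangle_angle[OF t(1)] sin_triangle_angle[OF t(2)] g power2_eq_square)
  moreover have "cos (triangle_angle b c a) * cos (triangle_angle a c b) =
      (cosh b * cosh c - cosh a) * (cosh a * cosh c - cosh b) / (sinh a * sinh b * (sinh c)\<^sup>2)"
    by (simp add: cos_triangle_angle[OF t(1)] cos_triangle_angle[OF t(2)] power2_eq_square)
  moreover have "cos (triangle_angle a b c) =
      (cosh a * cosh b - cosh c) * (sinh c)\<^sup>2 / (sinh a * sinh b * (sinh c)\<^sup>2)"
    using S by (simp add: cos_triangle_angle[OF assms])
  moreover have "(cosh a * cosh b - cosh c) * (sinh c)\<^sup>2 = gram a b c * cosh c
      - (cosh b * cosh c - cosh a) * (cosh a * cosh c - cosh b)"
    unfolding gram_def sinh_square_eq by algebra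
  ultimately show ?thesis
    by (simp add: diff_divide_distrib)
qed

text \<open>
  By the dual law of cosines, \<open>cos (\<alpha> + \<beta>) + cos \<gamma> = sin \<alpha> * sin \<beta> * (cosh c - 1) > 0\<close>, that is,
  \<open>cos (pi - \<gamma>) < cos (\<alpha> + \<beta>)\<close>.  Monotonicity of the cosine on \<open>[0, pi]\<close> compares \<open>pi - \<gamma>\<close> with
  \<open>\<alpha> + \<beta>\<close> itself if this sum is at most \<open>pi\<close> and with its reflection \<open>2 * pi - (\<alpha> + \<beta>)\<close> otherwise; the
  second case is excluded only afterwards, by using two pairs of angles.
\<close>

lemma angle_sum_less_pi_or_wrap:
  assumes "triangle_ineqs a b c"
  defines "\<alpha> \<equiv> triangle_angle b c a" and "\<beta> \<equiv> triangle_angle a c b"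
    and "\<gamma> \<equiv> triangle_angle a b c"
  shows "\<alpha> + \<beta> + \<gamma> < pi \<or> pi + \<gamma> < \<alpha> + \<beta>"
proof -
  have t: "triangle_ineqs b c a" "triangle_ineqs a c b"
    using triangle_ineqs_permute[OF assms(1)] by auto
  have b: "0 < \<alpha>" "\<alpha> < pi" "0 < \<beta>" "\<beta> < pi" "0 < \<gamma>" "\<gamma> < pi"
    unfolding \<alpha>_def \<beta>_def \<gamma>_def using triangle_angle_bounds assms(1) t by auto
  have "cos (\<alpha> + \<beta>) + cos \<gamma> = sin \<alpha> * sin \<beta> * (cosh c - 1)"
    using dual_law_of_cosines[OF assms(1)]
    by (simp add: \<alpha>_def \<beta>_def \<gamma>_def cos_add algebra_simps)
  moreover have "1 < cosh c" using triangle_ineqs_pos[OF assms(1)] 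
    by (metis cosh_0 cosh_real_nonneg_less_iff less_imp_le order_refl)
  ultimately have *: "cos (pi - \<gamma>) < cos (\<alpha> + \<beta>)"
    using b sin_gt_zero[of \<alpha>] sin_gt_zero[of \<beta>]
    by (smt (verit, ccfv_SIG) cos_pi_minus mult_pos_pos)
  show ?thesis
  proof (cases "\<alpha> + \<beta> \<le> pi")
    case True
    then have "\<alpha> + \<beta> < pi - \<gamma>"
      using * b cos_mono_less_eq[of "pi - \<gamma>" "\<alpha> + \<beta>"] by auto
    then show ?thesis by simp
  next
    case False
    have "cos (\<alpha> + \<beta>) = cos (2 * pi - (\<alpha> + \<beta>))" by (simp add: cos_diff)
    then have "2 * pi - (\<alpha> + \<beta>) < pi - \<gamma>"
      using * b False cos_mono_less_eq[of "pi - \<gamma>" "2 * pi - (\<alpha> + \<beta>)"] by auto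
    then show ?thesis by simp
  qed
qed

text \<open>
  The alternative \<open>pi + \<gamma> < \<alpha> + \<beta>\<close> is incompatible with either alternative for the pair \<open>\<alpha>\<close>, \<open>\<gamma>\<close>:
  it rules out an angle sum below \<open>pi\<close>, and adding \<open>pi + \<beta> < \<alpha> + \<gamma>\<close> would give \<open>pi < \<alpha>\<close>.
\<close>

lemma hyperbolic_angle_sum:
  assumes "triangle_ineqs a b c"
  shows "triangle_angle b c a + triangle_angle a c b + triangle_angle a b c < pi"
proof -
  have t: "triangle_ineqs b c a" "triangle_ineqs a c b" "triangle_ineqs c a b"
    using triangle_ineqs_permute[OF assms] by auto
  show ?thesis
    using angle_sum_less_pi_or_wrap[OF assms] angle_sum_less_pi_or_wrap[OF t(2)] 
      triangle_angle_bounds[OF assms] triangle_angle_bounds[OF t(1)]  triangle_angle_bounds[OF t(2)]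
      triangle_angle_commute[OF t(1)]
    by auto
qed

text \<open>
  For \<open>J \<le> 1\<close> the claim says that the cosine of the angle exceeds \<open>- J\<close>, that is,
  \<open>cosh c < cosh a * cosh b + J * sinh a * sinh b\<close>.  Since \<open>cosh c\<close> is the same expression in the
  smaller arguments \<open>s\<close>, \<open>t\<close> and \<open>J\<close> is nonnegative, this is monotonicity.  In the application \<open>s\<close> and
  \<open>t\<close> are the radii at the two other vertices.
\<close>

lemma triangle_angle_less_pi_minus_Lam:
  assumes "triangle_ineqs a b c" and "0 \<le> J" and "0 < s" "s < a" and "0 < t" "t < b"
    and c: "cosh c = cosh s * cosh t + J * sinh s * sinh t"
  shows "triangle_angle a b c < pi - Lam J"
proof (cases "J \<le> 1")
  case True
  have S: "0 < sinh a * sinh b" using assms by simp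
  have "cosh s * cosh t < cosh a * cosh b"
    using assms by (intro mult_strict_mono) (auto simp: cosh_real_nonneg_less_iff)
  moreover have "J * (sinh s * sinh t) \<le> J * (sinh a * sinh b)"
    using assms by (intro mult_left_mono mult_mono) auto
  ultimately have "- J < (cosh a * cosh b - cosh c) / (sinh a * sinh b)"
    using S by (simp add: c field_simps)
  then have "triangle_angle a b c < arccos (- J)"
    using cosine_bounds[OF assms(1)] \<open>0 \<le> J\<close> True
    by (simp add: triangle_angle_eq[OF assms(1)] arccos_less_mono)
  then show ?thesis using True \<open>0 \<le> J\<close> by (simp add: Lam_def arccos_minus)
next
  case False
  then show ?thesis using triangle_angle_bounds[OF assms(1)] by (simp add: Lam_def)
qed

section \<open>Inner angles of the faces\<close>

lemma cosh_edge_length: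
  assumes "0 < r i" "0 < r j" "0 \<le> I {i, j}"
  shows "cosh (edge_length I r i j) =
      cosh (r i) * cosh (r j) + I {i, j} * sinh (r i) * sinh (r j)"
    and "r i < edge_length I r i j" and "r j < edge_length I r i j"
proof -
  let ?x = "cosh (r i) * cosh (r j) + I {i, j} * sinh (r i) * sinh (r j)"
  have c: "1 < cosh (r i)" "1 < cosh (r j)"
    using assms by (metis cosh_0 cosh_real_nonneg_less_iff less_imp_le order_refl)+
  have "0 \<le> I {i, j} * sinh (r i) * sinh (r j)" using assms by simp
  moreover have "cosh (r i) * 1 < cosh (r i) * cosh (r j)"
    using c by (intro mult_strict_left_mono) auto
  moreover have "1 * cosh (r j) < cosh (r i) * cosh (r j)"
    using c by (intro mult_strict_right_mono) auto
  ultimately have x: "cosh (r i) < ?x" "cosh (r j) < ?x" by linarith+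
  then show "cosh (edge_length I r i j) = ?x"
    using c by (simp add: edge_length_def)
  have "arcosh (cosh (r i)) < arcosh ?x" "arcosh (cosh (r j)) < arcosh ?x"
    using x c by (intro arcosh_real_strict_mono; simp)+
  then show "r i < edge_length I r i j" and "r j < edge_length I r i j"
    using assms by (simp_all add: edge_length_def arcosh_cosh_real)
qed

lemma edge_length_commute: "edge_length I r i j = edge_length I r j i"
  by (simp add: edge_length_def insert_commute algebra_simps)

lemma triangle_ineqs_face:
  assumes "r \<in> Omega V F I" "{i, j, k} \<in> F"
  shows "triangle_ineqs (edge_length I r i j) (edge_length I r i k) (edge_length I r j k)"
  using assms unfolding Omega_def triangle_ineqs_def by (auto simp: algebra_simps)

lemma inner_angle_commute:
  assumes "r \<in> Omega V F I" "{i, j, k} \<in> F"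
  shows "inner_angle I r i k j = inner_angle I r i j k"
  using triangle_angle_commute[OF triangle_ineqs_face[OF assms]]
  by (simp add: inner_angle_def edge_length_commute[of I r k j])

lemma inner_angle_pos:
  assumes "r \<in> Omega V F I" "{i, j, k} \<in> F"
  shows "0 < inner_angle I r i j k"
  using triangle_angle_bounds(1)[OF triangle_ineqs_face[OF assms]] by (simp add: inner_angle_def)

lemma inner_angle_sum_less_pi:
  assumes "r \<in> Omega V F I" "{i, j, k} \<in> F"
  shows "inner_angle I r i j k + inner_angle I r j i k + inner_angle I r k i j < pi"
  using hyperbolic_angle_sum[OF triangle_ineqs_face[OF assms]]
  by (simp add: inner_angle_def edge_length_commute[of I r j i] edge_length_commute[of I r k]
      triangle_angle_commute)

lemma inner_angle_less_pi_minus_Lam: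
  assumes "r \<in> Omega V F I" "{i, j, k} \<in> F" "i \<in> V" "j \<in> V" "k \<in> V"
    and "0 \<le> I {i, j}" "0 \<le> I {i, k}" "0 \<le> I {j, k}"
  shows "inner_angle I r i j k < pi - Lam (I {j, k})"
proof -
  have "0 < r i" "0 < r j" "0 < r k" using assms by (auto simp: Omega_def)
  then show ?thesis
    unfolding inner_angle_def using assms cosh_edge_length[of r i j I] cosh_edge_length[of r i k I]
      cosh_edge_length[of r j k I]
    by (intro triangle_angle_less_pi_minus_Lam[OF triangle_ineqs_face, where s = "r j" and t = "r k"])
      auto
qed

section \<open>Triangulated surfaces\<close>

text \<open>
  The charts of a surface, pulled back to a subset \<open>S\<close> of a topological space that is homeomorphic to
  it.
\<close>

lemma surface_chart:
  fixes S :: "'a :: topological_space set"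
  assumes "closed_surface M" "top_of_set S homeomorphic_space M" "p \<in> S"
  obtains U and W :: "(real ^ 2) set" and k k'
  where "openin (top_of_set S) U" "p \<in> U" "open W" "homeomorphism U W k k'"
proof -
  obtain f g where fg: "homeomorphic_maps (top_of_set S) M f g"
    using assms(2) by (auto simp: homeomorphic_space_def)
  then have fp: "f p \<in> topspace M" and cf: "continuous_map (top_of_set S) M f"
    using assms(3) by (auto simp: homeomorphic_maps_def continuous_map_def)
  then obtain U0 and W :: "(real ^ 2) set" where U0: "openin M U0" "f p \<in> U0" "open W"
      "subtopology M U0 homeomorphic_space top_of_set W"
    using assms(1) unfolding closed_surface_def by meson
  define U where "U = {x \<in> S. f x \<in> U0}"
  have "openin (top_of_set S) U"
    using openin_continuous_map_preimage[OF cf U0(1)] by (simp add: U_def)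
  moreover have "homeomorphic_maps (subtopology (top_of_set S) U) (subtopology M U0) f g"
    using openin_subset[OF U0(1)] fg
    by (intro homeomorphic_maps_subtopologies_alt[OF fg])
      (auto simp: U_def homeomorphic_maps_def continuous_map_def Pi_iff)
  then have "subtopology (top_of_set S) U homeomorphic_space top_of_set W"
    using homeomorphic_space_trans[OF homeomorphic_maps_imp_homeomorphic_space U0(4)] by blast
  moreover have "subtopology (top_of_set S) U = top_of_set U"
    unfolding subtopology_subtopology U_def by (rule arg_cong[where f = "subtopology euclidean"]) auto
  ultimately obtain k k' where "homeomorphic_maps (top_of_set U) (top_of_set W) k k'"
    by (auto simp: homeomorphic_space_def)
  then have "homeomorphism U W k k'"
    unfolding homeomorphic_maps_def homeomorphism_def continuous_map_subtopology_eu
    by (force simp: image_iff Pi_iff)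
  then show thesis
    using that \<open>openin (top_of_set S) U\<close> U0 assms(3) by (auto simp: U_def)
qed

text \<open>
  In a chart, such a set would contain an open piece of the plane, and the injection would embed this
  piece in the line, against invariance of dimension.
\<close>

lemma no_open_subset_embeds_in_line:
  fixes S :: "'a :: topological_space set" and f :: "'a \<Rightarrow> real"
  assumes "closed_surface M" "top_of_set S homeomorphic_space M"
    and "openin (top_of_set S) G" "p \<in> G" "continuous_on G f" "inj_on f G"
  shows False
proof -
  have "p \<in> S" using assms(3,4) openin_imp_subset by blast
  then obtain U and W :: "(real ^ 2) set" and k k' where
    U: "openin (top_of_set S) U" "p \<in> U" "open W" and hom: "homeomorphism U W k k'"
    using surface_chart[OF assms(1,2)] by metis
  have "openin (top_of_set U) (U \<inter> G)"
    using U assms(3) by (metis inf_commute openin_Int openin_imp_subset openin_subset_trans inf_le1 Int_lower2)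
  then have "openin (top_of_set W) (k ` (U \<inter> G))"
    using hom homeomorphism_imp_open_map by blast
  then have op: "open (k ` (U \<inter> G))" using U(3) openin_open_eq by blast
  have k': "k' ` k ` (U \<inter> G) = U \<inter> G"
    using hom by (force simp: homeomorphism_def image_iff)
  have "k ` (U \<inter> G) \<subseteq> W" using hom by (auto simp: homeomorphism_def)
  then have ck: "continuous_on (k ` (U \<inter> G)) k'" and ik: "inj_on k' (k ` (U \<inter> G))"
    using hom by (auto simp: homeomorphism_def inj_on_def intro: continuous_on_subset)
  have "continuous_on (k ` (U \<inter> G)) (f \<circ> k')"
    using ck k' assms(5) by (intro continuous_on_compose) (auto intro: continuous_on_subset)
  moreover have "inj_on (f \<circ> k') (k ` (U \<inter> G))"
    using ik k' assms(6) by (intro comp_inj_on) (auto intro: inj_on_subset)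
  moreover have "k ` (U \<inter> G) \<noteq> {}" using assms(4) U by auto
  ultimately have "DIM(real ^ 2) \<le> DIM(real)"
    using invariance_of_dimension op by blast
  then show False by simp
qed

text \<open>
  Invariance of domain is local in the target, so it passes from the plane to surfaces by reading the
  map in charts.
\<close>

lemma invariance_of_domain_surface:
  fixes S :: "'a :: topological_space set" and \<phi> :: "real \<times> real \<Rightarrow> 'a"
  assumes "closed_surface M" "top_of_set S homeomorphic_space M"
    and "open D" "continuous_on D \<phi>" "inj_on \<phi> D" "\<phi> ` D \<subseteq> S"
  shows "openin (top_of_set S) (\<phi> ` D)"
proof (subst openin_subopen, intro ballI)
  fix p assume p: "p \<in> \<phi> ` D"
  then obtain U and W :: "(real ^ 2) set" and k k' where
    U: "openin (top_of_set S) U" "p \<in> U" "open W" and hom: "homeomorphism U W k k'"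
    using surface_chart[OF assms(1,2)] assms(6) by (metis subsetD)
  define D' where "D' = D \<inter> \<phi> -` U"
  have "openin (top_of_set D) D'"
    unfolding D'_def using continuous_openin_preimage[OF assms(4) _ U(1)] assms(6) by blast
  then have "open D'" using assms(3) openin_open_eq by blast
  have sub: "D' \<subseteq> D" "\<phi> ` D' \<subseteq> U" by (auto simp: D'_def)
  have ckU: "continuous_on U k" and ikU: "inj_on k U" and kU: "k ` U = W"
    using hom by (auto simp: homeomorphism_def inj_on_def) metis
  have "continuous_on D' (k \<circ> \<phi>)"
    using sub assms(4) ckU by (intro continuous_on_compose) (auto intro: continuous_on_subset)
  moreover have "inj_on (k \<circ> \<phi>) D'"
    using sub assms(5) ikU by (intro comp_inj_on) (auto intro: inj_on_subset)
  ultimately have "open ((k \<circ> \<phi>) ` D')"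
    using \<open>open D'\<close> by (intro invariance_of_domain_gen) auto
  then have "openin (top_of_set W) (k ` \<phi> ` D')"
    using sub kU U(3) by (auto simp: openin_open_eq image_comp)
  then have "openin (top_of_set U) (k' ` k ` \<phi> ` D')"
    using hom homeomorphism_imp_open_map homeomorphism_symD by blast
  moreover have "k' (k x) = x" if "x \<in> U" for x
    using hom that by (simp add: homeomorphism_def)
  then have "k' ` k ` \<phi> ` D' = \<phi> ` D'"
    using sub(2) unfolding image_image by (intro image_cong) auto
  ultimately have "openin (top_of_set S) (\<phi> ` D')"
    using U(1) openin_trans by metis
  moreover have "p \<in> \<phi> ` D'" using p U by (auto simp: D'_def)
  ultimately show "\<exists>T. openin (top_of_set S) T \<and> p \<in> T \<and> T \<subseteq> \<phi> ` D"
    using sub by blast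
qed

lemma openin_coordinate_pos: "openin (top_of_set S) {x \<in> S. 0 < (x :: nat \<Rightarrow> real) v}"
proof -
  have "open ((\<lambda>x :: nat \<Rightarrow> real. x v) -` {0<..})"
    by (intro open_vimage continuous_on_product_coordinates) auto
  then show ?thesis by (auto simp: openin_open)
qed

lemma realization_vertex: "{v} \<in> S \<Longrightarrow> (\<lambda>i. if i = v then 1 else 0) \<in> realization S"
  by (simp add: realization_def)

text \<open>
  A vertex outside all faces is either isolated or lies on an edge that is not in any face.  A point
  of the realization near the vertex, or near the interior of that edge, is then determined by its
  barycentric coordinate at the vertex, so that an open subset of the surface embeds in the line.
\<close>

lemma vertex_in_face:
  assumes M: "closed_surface M" and T: "triangulation_of V E F M" and v: "v \<in> V"
  shows "\<exists>f\<in>F. v \<in> f"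
proof (rule ccontr)
  assume nf: "\<not> ?thesis"
  define S where "S = realization (simplices V E F)"
  have hom: "top_of_set S homeomorphic_space M" and
    E: "\<And>e. e \<in> E \<Longrightarrow> e \<subseteq> V \<and> card e = 2"
    using T by (auto simp: triangulation_of_def two_dim_complex_def S_def)
  have pos: "0 \<le> x i" "{i. x i \<noteq> 0} \<in> simplices V E F" "(\<Sum>i | x i \<noteq> 0. x i) = 1" if "x \<in> S" for x i
    using that by (auto simp: S_def realization_def)
  have cont: "continuous_on G (\<lambda>x :: nat \<Rightarrow> real. x v)" for G
    by (rule continuous_on_subset[OF continuous_on_product_coordinates subset_UNIV])
  show False
  proof (cases "\<exists>e\<in>E. v \<in> e")
    case False
    define G where "G = {x \<in> S. 0 < x v}"
    have only_v: "\<sigma> = {v}" if "\<sigma> \<in> simplices V E F" "v \<in> \<sigma>" for \<sigma>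
      using that nf False by (auto simp: simplices_def)
    have supp: "{i. x i \<noteq> 0} = {v}" if "x \<in> G" for x
      by (rule only_v) (use that pos(2) in \<open>auto simp: G_def\<close>)
    have "(\<lambda>i. if i = v then 1 else 0) \<in> G"
    proof -
      have "{v} \<in> simplices V E F" using v by (simp add: simplices_def)
      then show ?thesis unfolding G_def S_def using realization_vertex by simp
    qed
    moreover have "inj_on (\<lambda>x. x v) G"
    proof (rule inj_onI)
      fix x y assume xy: "x \<in> G" "y \<in> G" "x v = y v"
      show "x = y"
      proof
        fix i
        have "x i = 0 \<and> y i = 0" if "i \<noteq> v"
          using that supp[OF xy(1)] supp[OF xy(2)] by blast
        then show "x i = y i" using xy(3) by (cases "i = v") simp_all
      qed
    qed
    ultimately show False
      using no_open_subset_embeds_in_line[OF M hom openin_coordinate_pos[of S v, folded G_def] _ cont]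
      by blast
  next
    case True
    then obtain e where e: "e \<in> E" "v \<in> e" by blast
    then obtain w where w: "e = {v, w}" "v \<noteq> w"
      using E[of e] by (auto simp: card_2_iff)
    define G where "G = {x \<in> S. 0 < x v} \<inter> {x \<in> S. 0 < x w}"
    have op: "openin (top_of_set S) G"
      unfolding G_def by (intro openin_Int openin_coordinate_pos)
    have only_e: "\<sigma> = {v, w}" if "\<sigma> \<in> simplices V E F" "v \<in> \<sigma>" "w \<in> \<sigma>" for \<sigma>
    proof -
      have "\<sigma> \<in> E" using that nf w(2) by (auto simp: simplices_def)
      then have "card \<sigma> = 2" using E by blast
      then show ?thesis using that w(2) by (auto simp: card_2_iff)
    qed
    have supp: "{i. x i \<noteq> 0} = {v, w}" if "x \<in> G" for x
      by (rule only_e) (use that pos(2) in \<open>auto simp: G_def\<close>)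
    have "(\<lambda>i. if i = v \<or> i = w then 1/2 else 0) \<in> G"
    proof -
      have "{i. (if i = v \<or> i = w then 1/2 else 0 :: real) \<noteq> 0} = {v, w}" by auto
      then show ?thesis using e w by (auto simp: G_def S_def realization_def simplices_def)
    qed
    moreover have "inj_on (\<lambda>x. x v) G"
    proof (rule inj_onI)
      fix x y assume xy: "x \<in> G" "y \<in> G" "x v = y v"
      have "x v + x w = 1" "y v + y w = 1"
        using pos(3)[of x, unfolded supp[OF xy(1)]] pos(3)[of y, unfolded supp[OF xy(2)]] xy w(2)
        by (simp_all add: G_def)
      then have "x w = y w" using xy(3) by simp
      show "x = y"
      proof
        fix i
        have "x i = 0 \<and> y i = 0" if "i \<notin> {v, w}"
          using that supp[OF xy(1)] supp[OF xy(2)] by blast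
        then show "x i = y i" using xy(3) \<open>x w = y w\<close> by (cases "i \<in> {v, w}") auto
      qed
    qed
    ultimately show False
      using no_open_subset_embeds_in_line[OF M hom op _ cont] by blast
  qed
qed

text \<open>
  The three triangles form a book with three pages.  Two of the pages, glued along the edge \<open>{a, b}\<close>, contain a disc around the
  midpoint of this edge, and by invariance of domain this disc is open in the surface.  But the third
  page contains points that are arbitrarily close to the midpoint and not in the disc.
\<close>

lemma no_three_pages:
  assumes M: "closed_surface M" and T: "triangulation_of V E F M"
    and F: "{a, b, c} \<in> F" "{a, b, d} \<in> F" "{a, b, g} \<in> F"
    and d: "distinct [a, b, c, d, g]"
  shows False
proof -
  define S where "S = realization (simplices V E F)"
  have hom: "top_of_set S homeomorphic_space M"
    using T by (auto simp: triangulation_of_def S_def)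
  have sub: "\<sigma> \<in> simplices V E F" if "\<sigma> \<subseteq> \<tau>" "\<sigma> \<noteq> {}" "\<tau> \<in> F" for \<sigma> \<tau>
  proof -
    have "\<tau> \<in> simplices V E F" using that by (simp add: simplices_def)
    then show ?thesis
      using T that(1,2) unfolding triangulation_of_def two_dim_complex_def by blast
  qed
  have mem: "x \<in> S" if "\<tau> \<in> F" "\<And>i. 0 \<le> x i" "\<And>i. i \<notin> \<tau> \<Longrightarrow> x i = 0" "sum x \<tau> = 1" for x \<tau>
  proof -
    have "finite \<tau>"
      using T that(1) unfolding triangulation_of_def two_dim_complex_def
      by (intro card_ge_0_finite) simp
    moreover have sup: "{i. x i \<noteq> 0} \<subseteq> \<tau>" using that by blast
    ultimately have "(\<Sum>i | x i \<noteq> 0. x i) = sum x \<tau>"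
      by (intro sum.mono_neutral_left) simp_all
    then have sum: "(\<Sum>i | x i \<noteq> 0. x i) = 1" using that(4) by simp
    then have "{i. x i \<noteq> 0} \<noteq> {}" by (metis sum.empty zero_neq_one)
    then show ?thesis
      using that(2) sub[OF sup] that(1) sum by (simp add: S_def realization_def)
  qed
  \<comment> \<open>The disc in the first two pages: \<open>fst z\<close> is the coordinate at \<open>a\<close>, and the sign of \<open>snd z\<close>
    decides whether its absolute value is the coordinate at \<open>c\<close> or at \<open>d\<close>.\<close>
  define D :: "(real \<times> real) set" where "D = {z. 0 < fst z} \<inter> {z. 0 < 1 - fst z - \<bar>snd z\<bar>}"
  define \<phi> :: "real \<times> real \<Rightarrow> nat \<Rightarrow> real" where
    "\<phi> = (\<lambda>z i. if i = a then fst z else if i = b then 1 - fst z - \<bar>snd z\<bar>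
       else if i = c then max (snd z) 0 else if i = d then max (- snd z) 0 else 0)"
  have "open D"
    unfolding D_def by (intro open_Int open_Collect_less continuous_intros)
  moreover have cont: "continuous_on D \<phi>"
  proof (rule continuous_on_coordinatewise_then_product)
    fix i show "continuous_on D (\<lambda>z. \<phi> z i)"
      unfolding \<phi>_def by (cases "i = a"; cases "i = b"; cases "i = c"; cases "i = d")
        (auto intro!: continuous_intros)
  qed
  moreover have "inj_on \<phi> D"
  proof (rule inj_onI)
    fix y z assume "\<phi> y = \<phi> z"
    then have "\<phi> y a = \<phi> z a" "\<phi> y c = \<phi> z c" "\<phi> y d = \<phi> z d" by simp_all
    then show "y = z" using d by (auto simp: \<phi>_def prod_eq_iff max_def split: if_splits)
  qed
  moreover have "\<phi> ` D \<subseteq> S"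
  proof (intro image_subsetI)
    fix z assume z: "z \<in> D"
    show "\<phi> z \<in> S"
    proof (cases "0 \<le> snd z")
      case True
      then show ?thesis using z d by (intro mem[OF F(1)]) (auto simp: \<phi>_def D_def)
    next
      case False
      then show ?thesis using z d by (intro mem[OF F(2)]) (auto simp: \<phi>_def D_def)
    qed
  qed
  ultimately have "openin (top_of_set S) (\<phi> ` D)"
    using invariance_of_domain_surface[OF M hom] by blast
  \<comment> \<open>A path in the third page that starts at the midpoint of the edge.\<close>
  moreover define \<gamma> :: "real \<Rightarrow> nat \<Rightarrow> real" where
    "\<gamma> = (\<lambda>t i. if i = a then (1 - t) / 2 else if i = b then (1 - t) / 2 else if i = g then t else 0)"
  have \<gamma>S: "\<gamma> ` {0..1} \<subseteq> S"
    using d by (intro image_subsetI mem[OF F(3)]) (auto simp: \<gamma>_def)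
  have "continuous_on {0..1} \<gamma>"
  proof (rule continuous_on_coordinatewise_then_product)
    fix i show "continuous_on {0..1} (\<lambda>t. \<gamma> t i)"
      unfolding \<gamma>_def by (cases "i = a"; cases "i = b"; cases "i = g") (auto intro!: continuous_intros)
  qed
  ultimately have "openin (top_of_set {0..1}) ({0..1} \<inter> \<gamma> -` (\<phi> ` D))"
    using \<gamma>S continuous_openin_preimage by blast
  moreover have "\<gamma> 0 = \<phi> (1/2, 0)" using d by (auto simp: \<gamma>_def \<phi>_def)
  moreover have "(1/2, 0) \<in> D" by (simp add: D_def)
  ultimately obtain e where e: "0 < e" "\<And>t. t \<in> {0..1} \<Longrightarrow> dist t 0 < e \<Longrightarrow> \<gamma> t \<in> \<phi> ` D"
    unfolding openin_euclidean_subtopology_iff by (metis (no_types, lifting) IntD2 IntI atLeastAtMost_iff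
        imageI order_refl vimageE vimageI zero_le_one)
  define t where "t = min (e / 2) 1"
  have t: "0 < t" "t \<le> 1" "t < e" using e(1) by (auto simp: t_def)
  then obtain z where "\<gamma> t = \<phi> z" using e(2)[of t] by auto
  then have "\<gamma> t g = \<phi> z g" by simp
  then show False using t d by (auto simp: \<gamma>_def \<phi>_def)
qed

lemma edge_in_at_most_two_faces:
  assumes M: "closed_surface M" and T: "triangulation_of V E F M" and "e \<in> E" "finite F"
  shows "card {f \<in> F. e \<subseteq> f} \<le> 2"
proof (rule ccontr)
  assume "\<not> ?thesis"
  then have "3 \<le> card {f \<in> F. e \<subseteq> f}" by simp
  then obtain X where X: "X \<subseteq> {f \<in> F. e \<subseteq> f}" "card X = 3"
    by (meson obtain_subset_with_card_n)
  then obtain f1 f2 f3 where f: "X = {f1, f2, f3}" "f1 \<noteq> f2" "f1 \<noteq> f3" "f2 \<noteq> f3"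
    by (auto simp: card_3_iff)
  have cE: "card e = 2" and cF: "\<And>f. f \<in> F \<Longrightarrow> card f = 3"
    using T assms(3) by (auto simp: triangulation_of_def two_dim_complex_def)
  obtain a b where ab: "e = {a, b}" "a \<noteq> b" using cE by (auto simp: card_2_iff)
  have page: "\<exists>c. f = {a, b, c} \<and> c \<noteq> a \<and> c \<noteq> b" if "f \<in> X" for f
  proof -
    have f: "f \<in> F" "e \<subseteq> f" using that X by auto
    then have "card (f - e) = 1" using cE cF[of f] card_Diff_subset[of e f]
      by (metis One_nat_def Suc_eq_plus1 ab(1) add_diff_cancel_left' eval_nat_numeral(3) finite.emptyI finite_insert)
    then obtain c where "f - e = {c}" by (auto simp: card_1_singleton_iff)
    then have "f = {a, b, c} \<and> c \<noteq> a \<and> c \<noteq> b" using f ab by blast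
    then show ?thesis ..
  qed
  obtain c d g where pages: "f1 = {a, b, c}" "f2 = {a, b, d}" "f3 = {a, b, g}"
    and dist: "distinct [a, b, c, d, g]"
    using page[of f1] page[of f2] page[of f3] f ab(2) by fastforce
  have "f1 \<in> F" "f2 \<in> F" "f3 \<in> F" using X(1) f(1) by auto
  then show False
    using no_three_pages[OF M T _ _ _ dist] unfolding pages by blast
qed

section \<open>Angle sums over the faces\<close>

text \<open>
  The inner angle at \<open>i\<close> as a function of the face \<open>f\<close> alone.  The two other vertices are taken in
  increasing order, as in the definition of the curvature.
\<close>

definition face_angle ::
  "(nat set \<Rightarrow> real) \<Rightarrow> (nat \<Rightarrow> real) \<Rightarrow> nat set \<Rightarrow> nat \<Rightarrow> real" where
  "face_angle I r f i = inner_angle I r i (Min (f - {i})) (Max (f - {i}))"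

lemma card_3_obtain_sorted:
  fixes f :: "nat set"
  assumes "card f = 3" "i \<in> f"
  obtains j k where "f = {i, j, k}" "j < k" "i \<noteq> j" "i \<noteq> k"
proof -
  have "card (f - {i}) = 2" using assms by (simp add: card_Diff_singleton)
  then obtain j k where jk: "f - {i} = {j, k}" "j \<noteq> k" by (auto simp: card_2_iff)
  then have "f = {i, j, k}" "i \<noteq> j" "i \<noteq> k" using assms(2) by auto
  then show thesis
    using that[of j k] that[of k j] jk(2) by (metis insert_commute nat_neq_iff)
qed

lemma face_angle_eq:
  assumes "r \<in> Omega V F I" "{i, j, k} \<in> F" "i \<noteq> j" "i \<noteq> k"
  shows "face_angle I r {i, j, k} i = inner_angle I r i j k"
proof -
  have "{i, j, k} - {i} = {j, k}" using assms by auto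
  then have "face_angle I r {i, j, k} i = inner_angle I r i (min j k) (max j k)"
    by (simp add: face_angle_def)
  then show ?thesis
    using inner_angle_commute[OF assms(1,2)] by (simp add: min_def max_def)
qed

lemma curvature_eq_face_angles:
  assumes "r \<in> Omega V F I" and card: "\<And>f. f \<in> F \<Longrightarrow> card f = 3"
  shows "curvature F I r i = 2 * pi - (\<Sum>f\<in>{f \<in> F. i \<in> f}. face_angle I r f i)"
proof -
  have ne: "i \<noteq> j \<and> i \<noteq> k" if "{i, j, k} \<in> F" for j k
    using card[OF that] by (auto simp: card_insert_if split: if_splits)
  have MM: "Min ({i, j, k} - {i}) = j" "Max ({i, j, k} - {i}) = k"
    if "j < k" "{i, j, k} \<in> F" for j k
  proof -
    have "{i, j, k} - {i} = {j, k}" using ne[OF that(2)] by auto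
    then show "Min ({i, j, k} - {i}) = j" "Max ({i, j, k} - {i}) = k"
      using that(1) by simp_all
  qed
  have inv: "Min (f - {i}) < Max (f - {i}) \<and> {i, Min (f - {i}), Max (f - {i})} = f"
    if "f \<in> F" "i \<in> f" for f
  proof -
    have "card f = 3" using card that by blast
    then obtain j k where "f = {i, j, k}" "j < k"
      using card_3_obtain_sorted \<open>i \<in> f\<close> by metis
    then show ?thesis using MM[of j k] that by simp
  qed
  have "(\<Sum>(j, k) | j < k \<and> {i, j, k} \<in> F. inner_angle I r i j k) =
      (\<Sum>f\<in>{f \<in> F. i \<in> f}. face_angle I r f i)"
    by (rule sum.reindex_bij_witness[where j = "\<lambda>(j, k). {i, j, k}"
            and i = "\<lambda>f. (Min (f - {i}), Max (f - {i}))"])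
      (use inv MM in \<open>auto simp: face_angle_def\<close>)
  then show ?thesis by (simp add: curvature_def)
qed

text \<open>
  The bound is \<open>pi - Lam (I e)\<close>, where \<open>e\<close> is the opposite edge, if \<open>f\<close> has one vertex in \<open>A\<close>, and \<open>pi\<close>
  if it has two or three.  In the last case \<open>pi\<close> is written as \<open>3 * pi - 2 * pi\<close>, so that the binomial
  coefficient counts the edges of \<open>f\<close> inside \<open>A\<close> and the last term the faces inside \<open>A\<close>; summed over
  all faces these two become the edge and face terms of the Euler characteristic.
\<close>

lemma face_angle_sum_bound:
  assumes r: "r \<in> Omega V F I" and f: "f \<in> F" "card f = 3" "f \<subseteq> V"
    and I: "\<And>e. e \<subseteq> f \<Longrightarrow> card e = 2 \<Longrightarrow> 0 \<le> I e"
    and A: "f \<inter> A \<noteq> {}"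
  shows "(\<Sum>i\<in>f \<inter> A. face_angle I r f i) <
    (if card (f \<inter> A) = 1 then pi - Lam (I (f - A)) else 0)
      + pi * (card (f \<inter> A) choose 2) - 2 * pi * (if f \<subseteq> A then 1 else 0)"
proof -
  have fin: "finite f" using f(2) by (metis card.infinite zero_neq_numeral)
  have "card (f \<inter> A) \<le> 3" using card_mono[OF fin, of "f \<inter> A"] f(2) by simp
  moreover have "card (f \<inter> A) \<noteq> 0" using A fin by simp
  ultimately consider "card (f \<inter> A) = 1" | "card (f \<inter> A) = 2" | "card (f \<inter> A) = 3"
    by linarith
  then show ?thesis
  proof cases
    case 1
    then obtain i where i: "f \<inter> A = {i}" by (auto simp: card_1_singleton_iff)
    then obtain j k where jk: "f = {i, j, k}" "j < k" "i \<noteq> j" "i \<noteq> k"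
      using card_3_obtain_sorted[OF f(2), of i] by blast
    then have "f - A = {j, k}" "\<not> f \<subseteq> A" using i by auto
    moreover have "inner_angle I r i j k < pi - Lam (I {j, k})"
      using f jk by (intro inner_angle_less_pi_minus_Lam[OF r] I) auto
    ultimately show ?thesis
      using i jk f(1) face_angle_eq[OF r, of i j k] by (auto simp: binomial_eq_0)
  next
    case 2
    then obtain i j where ij: "f \<inter> A = {i, j}" "i \<noteq> j" by (auto simp: card_2_iff)
    have "card (f - {i, j}) = 1" using f(2) ij fin by (subst card_Diff_subset) auto
    then obtain k where "f - {i, j} = {k}" by (auto simp: card_1_singleton_iff)
    then have k: "f = {i, j, k}" "i \<noteq> k" "j \<noteq> k" using ij by auto
    have k': "f = {j, i, k}" using k by auto
    have "\<not> f \<subseteq> A" using ij k by auto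
    moreover have "(\<Sum>i\<in>f \<inter> A. face_angle I r f i) = face_angle I r f i + face_angle I r f j"
      using ij by simp
    moreover have "face_angle I r f i = inner_angle I r i j k"
      using face_angle_eq[OF r, of i j k] f(1) k ij by simp
    moreover have "face_angle I r f j = inner_angle I r j i k"
      using face_angle_eq[OF r, of j i k] f(1) k k' ij by simp
    moreover have "0 < inner_angle I r k i j"
      using inner_angle_pos[OF r, of k i j] f(1) k by (simp add: insert_commute)
    moreover have "inner_angle I r i j k + inner_angle I r j i k + inner_angle I r k i j < pi"
      using inner_angle_sum_less_pi[OF r] f(1) k(1) by blast
    ultimately show ?thesis using 2 by simp
  next
    case 3
    then have fA: "f \<inter> A = f" using f(2) fin by (simp add: card_subset_eq)
    then obtain i j k where ijk: "f = {i, j, k}" "i \<noteq> j" "i \<noteq> k" "j \<noteq> k"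
      using f(2) by (auto simp: card_3_iff)
    then have p: "f = {j, i, k}" "f = {k, i, j}" by auto
    have "face_angle I r f i = inner_angle I r i j k" "face_angle I r f j = inner_angle I r j i k"
      "face_angle I r f k = inner_angle I r k i j"
      using face_angle_eq[OF r, of i j k] face_angle_eq[OF r, of j i k]
        face_angle_eq[OF r, of k i j] f(1) ijk p by simp_all
    moreover have "(\<Sum>i\<in>f. face_angle I r f i) =
        face_angle I r f i + face_angle I r f j + face_angle I r f k"
      using ijk by simp
    moreover have "card (f \<inter> A) choose 2 = 3" by (simp add: 3 eval_nat_numeral)
    ultimately show ?thesis
      using inner_angle_sum_less_pi[OF r, of i j k] f(1) ijk(1) fA 3 by auto
  qed
qed

section \<open>Counting faces and edges\<close>

lemma link_sum:
  assumes card: "\<And>f. f \<in> F \<Longrightarrow> card f = 3" and "finite F"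
    and sub: "\<And>e f. f \<in> F \<Longrightarrow> e \<subseteq> f \<Longrightarrow> card e = 2 \<Longrightarrow> e \<in> E"
  shows "(\<Sum>(e, v)\<in>Lk E F A. g e) =
    (\<Sum>f\<in>F. if card (f \<inter> A) = 1 then g (f - A) else (0 :: real))"
proof -
  have "(\<Sum>(e, v)\<in>Lk E F A. g e) = (\<Sum>f\<in>{f \<in> F. card (f \<inter> A) = 1}. g (f - A))"
  proof (rule sum.reindex_bij_witness[where j = "\<lambda>(e, v). insert v e"
        and i = "\<lambda>f. (f - A, the_elem (f \<inter> A))"])
    fix z assume "z \<in> Lk E F A"
    then obtain e v where z: "z = (e, v)" "e \<inter> A = {}" "v \<in> A" "insert v e \<in> F"
      by (auto simp: Lk_def)
    then have eq: "insert v e - A = e" "insert v e \<inter> A = {v}" by auto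
    then show "((case z of (e, v) \<Rightarrow> insert v e) - A,
        the_elem ((case z of (e, v) \<Rightarrow> insert v e) \<inter> A)) = z"
      and "(case z of (e, v) \<Rightarrow> insert v e) \<in> {f \<in> F. card (f \<inter> A) = 1}"
      and "g ((case z of (e, v) \<Rightarrow> insert v e) - A) = (case z of (e, v) \<Rightarrow> g e)"
      using z by simp_all
  next
    fix f assume f: "f \<in> {f \<in> F. card (f \<inter> A) = 1}"
    then obtain v where v: "f \<inter> A = {v}" by (auto simp: card_1_singleton_iff)
    then have eq: "insert v (f - A) = f" by auto
    have "finite f" using card[of f] f by (metis card.infinite mem_Collect_eq zero_neq_numeral)
    then have "card (f - A) = 2"
      using card[of f] f by (simp add: card_Diff_subset_Int)
    then show "(case (f - A, the_elem (f \<inter> A)) of (e, v) \<Rightarrow> insert v e) = f"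
      and "(f - A, the_elem (f \<inter> A)) \<in> Lk E F A"
      using v eq f sub[of f "f - A"] by (auto simp: Lk_def)
  qed
  also have "\<dots> = (\<Sum>f\<in>F. if card (f \<inter> A) = 1 then g (f - A) else 0)"
    using \<open>finite F\<close> by (simp add: sum.If_cases Int_def)
  finally show ?thesis .
qed

text \<open>
  Double counting of the pairs of a face \<open>f\<close> and an edge of \<open>f\<close> with both ends in \<open>A\<close>: by faces their
  number is the left side, by edges it is at most the right side.
\<close>

lemma edge_face_incidences:
  assumes "finite F" and "finite E"
    and card: "\<And>f. f \<in> F \<Longrightarrow> card f = 3"
    and sub: "\<And>e f. f \<in> F \<Longrightarrow> e \<subseteq> f \<Longrightarrow> card e = 2 \<Longrightarrow> e \<in> E"
    and cardE: "\<And>e. e \<in> E \<Longrightarrow> card e = 2"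
    and two: "\<And>e. e \<in> E \<Longrightarrow> card {f \<in> F. e \<subseteq> f} \<le> 2"
  shows "(\<Sum>f\<in>F. card (f \<inter> A) choose 2) \<le> 2 * card {e \<in> E. e \<subseteq> A}"
proof -
  have "card (f \<inter> A) choose 2 = card {e \<in> {e \<in> E. e \<subseteq> A}. e \<subseteq> f}" if "f \<in> F" for f
  proof -
    have "finite f" using card[OF that] by (metis card.infinite zero_neq_numeral)
    then have "card (f \<inter> A) choose 2 = card {e. e \<subseteq> f \<inter> A \<and> card e = 2}"
      using n_subsets[of "f \<inter> A" 2] by simp
    also have "{e. e \<subseteq> f \<inter> A \<and> card e = 2} = {e \<in> {e \<in> E. e \<subseteq> A}. e \<subseteq> f}"
      using sub[OF that] cardE by auto
    finally show ?thesis .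
  qed
  then have "(\<Sum>f\<in>F. card (f \<inter> A) choose 2) = (\<Sum>f\<in>F. \<Sum>e\<in>{e \<in> {e \<in> E. e \<subseteq> A}. e \<subseteq> f}. 1)"
    by simp
  also have "\<dots> = (\<Sum>e\<in>{e \<in> E. e \<subseteq> A}. \<Sum>f\<in>{f \<in> F. e \<subseteq> f}. 1)"
    using assms(1,2) by (intro sum.swap_restrict) auto
  also have "\<dots> \<le> (\<Sum>e\<in>{e \<in> E. e \<subseteq> A}. 2)"
    using two by (intro sum_mono) simp
  finally show ?thesis by simp
qed

lemma euler_char_subcomplex:
  assumes "A \<subseteq> V" "finite V" "finite E" "finite F"
    and cardE: "\<And>e. e \<in> E \<Longrightarrow> card e = 2" and cardF: "\<And>f. f \<in> F \<Longrightarrow> card f = 3"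
  shows "euler_char (subcomplex V E F A) =
    int (card A) - int (card {e \<in> E. e \<subseteq> A}) + int (card {f \<in> F. f \<subseteq> A})"
proof -
  let ?V = "(\<lambda>v. {v}) ` A" and ?E = "{e \<in> E. e \<subseteq> A}" and ?F = "{f \<in> F. f \<subseteq> A}"
  have fin: "finite ?V" "finite ?E" "finite ?F"
    using assms by (auto intro: finite_subset)
  have eq: "subcomplex V E F A = (?V \<union> ?E) \<union> ?F"
    using assms(1) by (auto simp: subcomplex_def simplices_def)
  have dis: "(?V \<union> ?E) \<inter> ?F = {}" "?V \<inter> ?E = {}"
    using cardE cardF by force+
  have "card ?V = card A" by (simp add: card_image)
  then show ?thesis
    unfolding euler_char_def eq using fin dis cardE cardF
    by (simp add: sum.union_disjoint sum.reindex)
qed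

section \<open>The curvature estimate\<close>

theorem theorem4p2:
  fixes M :: "'m topology"
    and N :: nat
    and E F :: "nat set set"
    and I :: "nat set \<Rightarrow> real"
    and r :: "nat \<Rightarrow> real"
    and A :: "nat set"
  assumes "closed_surface M"
    and "triangulation_of {1..N} E F M"
    and "\<forall>e\<in>E. 0 \<le> I e"
    and "r \<in> Omega {1..N} F I"
    and "A \<noteq> {}" and "A \<subset> {1..N}"
  shows "(\<Sum>i\<in>A. curvature F I r i) >
      - (\<Sum>(e, v)\<in>Lk E F A. pi - Lam (I e))
      + 2 * pi * of_int (euler_char (subcomplex {1..N} E F A))"
proof -
  let ?V = "{1..N}"
  have cardE: "card e = 2" "e \<subseteq> ?V" if "e \<in> E" for e
    using assms(2) that by (auto simp: triangulation_of_def two_dim_complex_def)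
  have cardF: "card f = 3" "f \<subseteq> ?V" if "f \<in> F" for f
    using assms(2) that by (auto simp: triangulation_of_def two_dim_complex_def)
  have fin: "finite E" "finite F" "finite A"
    using cardE(2) cardF(2) assms(6) finite_subset[of E "Pow ?V"] finite_subset[of F "Pow ?V"]
      finite_subset[of A ?V] by auto
  have sub: "e \<in> E" if "f \<in> F" "e \<subseteq> f" "card e = 2" for e f
  proof -
    have "e \<in> simplices ?V E F"
      using assms(2) that unfolding triangulation_of_def two_dim_complex_def
      by (metis UnI2 card.empty simplices_def zero_neq_numeral)
    then show ?thesis using that(3) cardF(1) by (auto simp: simplices_def)
  qed
  have inc: "(\<Sum>f\<in>F. card (f \<inter> A) choose 2) \<le> 2 * card {e \<in> E. e \<subseteq> A}"
    by (rule edge_face_incidences[OF fin(2,1) cardF(1) sub cardE(1)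
        edge_in_at_most_two_faces[OF assms(1,2) _ fin(2)]])
  define s where "s f = (\<Sum>i\<in>f \<inter> A. face_angle I r f i)" for f
  define lk where "lk f = (if card (f \<inter> A) = 1 then pi - Lam (I (f - A)) else 0)" for f
  define b where "b f = lk f + pi * real (card (f \<inter> A) choose 2)
      - 2 * pi * (if f \<subseteq> A then 1 else 0)" for f
  have strict: "s f < b f" if "f \<in> F" "f \<inter> A \<noteq> {}" for f
    unfolding s_def b_def lk_def using that cardF assms(3) sub
    by (intro face_angle_sum_bound[OF assms(4)]) blast+
  have weak: "s f \<le> b f" if "f \<in> F" for f
  proof (cases "f \<inter> A = {}")
    case True
    moreover have "f \<noteq> {}" using cardF(1)[OF that] by auto
    ultimately have "\<not> f \<subseteq> A" by blast
    then show ?thesis using True by (simp add: s_def b_def lk_def)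
  qed (use strict that in force)
  \<comment> \<open>Strictness of the sum comes from one face that has a vertex in \<open>A\<close>.\<close>
  obtain a where a: "a \<in> A" using assms(5) by blast
  then obtain f0 where "f0 \<in> F" "a \<in> f0"
    using vertex_in_face[OF assms(1,2), of a] assms(6) by blast
  then have "sum s F < sum b F"
    using a fin weak strict by (intro sum_strict_mono_ex1) blast+
  also have "sum b F = sum lk F + pi * real (\<Sum>f\<in>F. card (f \<inter> A) choose 2)
      - 2 * pi * real (card {f \<in> F. f \<subseteq> A})"
    using fin(2) by (simp add: b_def sum.distrib sum_subtractf sum_distrib_left[symmetric]
        sum.If_cases Int_def)
  also have "\<dots> \<le> sum lk F + pi * real (2 * card {e \<in> E. e \<subseteq> A})
      - 2 * pi * real (card {f \<in> F. f \<subseteq> A})"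
    using inc by (intro diff_right_mono add_left_mono mult_left_mono of_nat_mono) auto
  finally have angles: "sum s F < sum lk F + 2 * pi * real (card {e \<in> E. e \<subseteq> A})
      - 2 * pi * real (card {f \<in> F. f \<subseteq> A})"
    by simp
  have "(\<Sum>i\<in>A. curvature F I r i) =
      2 * pi * real (card A) - (\<Sum>i\<in>A. \<Sum>f\<in>{f \<in> F. i \<in> f}. face_angle I r f i)"
    using curvature_eq_face_angles[OF assms(4) cardF(1)] by (simp add: sum_subtractf)
  also have "(\<Sum>i\<in>A. \<Sum>f\<in>{f \<in> F. i \<in> f}. face_angle I r f i) =
      (\<Sum>f\<in>F. \<Sum>i\<in>{i \<in> A. i \<in> f}. face_angle I r f i)"
    using fin by (intro sum.swap_restrict) auto
  also have "\<dots> = sum s F"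
    by (simp add: s_def Int_def conj_commute)
  finally have "(\<Sum>i\<in>A. curvature F I r i) = 2 * pi * real (card A) - sum s F" .
  moreover have "(\<Sum>(e, v)\<in>Lk E F A. pi - Lam (I e)) = sum lk F"
    unfolding lk_def by (rule link_sum[OF cardF(1) fin(2) sub])
  moreover have "euler_char (subcomplex ?V E F A) =
      int (card A) - int (card {e \<in> E. e \<subseteq> A}) + int (card {f \<in> F. f \<subseteq> A})"
    using assms(6) fin cardE(1) cardF(1) by (intro euler_char_subcomplex) auto
  then have "2 * pi * of_int (euler_char (subcomplex ?V E F A)) = 2 * pi * real (card A)
      - 2 * pi * real (card {e \<in> E. e \<subseteq> A}) + 2 * pi * real (card {f \<in> F. f \<subseteq> A})"
    by (simp add: distrib_left right_diff_distrib)
  ultimately show ?thesis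
    using angles by linarith
qed

end
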